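(* Let $X$ be a strongly homogeneous separable metrizable zero-dimensional space. Then $X$ is a precompact strongly rectifiable space. Moreover, there exists a precompact strong Mal'tsev operation $P$ on $X$ such that the compact extension $\widehat{(X,P)}$ is homeomorphic to the Cantor set.
   Context: A space $X$ is strongly homogeneous if every nonempty clopen subset of $X$ is homeomorphic to $X$. A map $P:X^3\to X$ is a Mal'tsev operation if $P(x,y,y)=P(y,y,x)=x$ for all $x,y\in X$. A continuous Mal'tsev operation $P$ is a strong Mal'tsev operation if in addition $P(x,y,P(y,z,u))=P(x,z,u)$ for all $x,y,z,u\in X$. A continuous Mal'tsev operation $P$ on $X$ is precompact if there is a Hausdorff compact extension $bX$ of $X$ (a compact Hausdorff space containing $X$ as a dense subspace) such that $P$ extends to a continuous map $\widehat P: bX^3\to bX$. Such an extension $bX$ is unique up to a homeomorphism fixing $X$ pointwise, and is denoted $\widehat{(X,P)}$. A space $X$ is precompact strongly rectifiable if there exists a continuous precompact strong Mal'tsev operation on $X$.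
   Formalization: The "moreover" part is stated only for X with at least two points, since it fails for the empty and the one-point space, whose compact extension is not the Cantor set. *)

theory Defs
  imports "HOL-Analysis.Analysis"
begin

definition strongly_homogeneous :: "'a topology \<Rightarrow> bool" where
  "strongly_homogeneous X \<longleftrightarrow>
     (\<forall>U. openin X U \<and> closedin X U \<and> U \<noteq> {} \<longrightarrow> subtopology X U homeomorphic_space X)"

abbreviation cube_topology :: "'a topology \<Rightarrow> ('a \<times> 'a \<times> 'a) topology" where
  "cube_topology X \<equiv> prod_topology X (prod_topology X X)"

(* The range condition, P mapping the cube of X into X, is part of continuous_map. *)
definition continuous_maltsev :: "'a topology \<Rightarrow> ('a \<Rightarrow> 'a \<Rightarrow> 'a \<Rightarrow> 'a) \<Rightarrow> bool" where
  "continuous_maltsev X P \<longleftrightarrow>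
     continuous_map (cube_topology X) X (\<lambda>(x, y, z). P x y z) \<and>
     (\<forall>x\<in>topspace X. \<forall>y\<in>topspace X. P x y y = x \<and> P y y x = x)"

definition strong_maltsev :: "'a topology \<Rightarrow> ('a \<Rightarrow> 'a \<Rightarrow> 'a \<Rightarrow> 'a) \<Rightarrow> bool" where
  "strong_maltsev X P \<longleftrightarrow>
     continuous_maltsev X P \<and>
     (\<forall>x\<in>topspace X. \<forall>y\<in>topspace X. \<forall>z\<in>topspace X. \<forall>u\<in>topspace X.
        P x y (P y z u) = P x z u)"

(* A compact Hausdorff extension of X is a compact Hausdorff space B together with a
   dense embedding e of X into B. *)
definition compact_extension :: "'a topology \<Rightarrow> 'b topology \<Rightarrow> ('a \<Rightarrow> 'b) \<Rightarrow> bool" where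
  "compact_extension X B e \<longleftrightarrow>
     compact_space B \<and> Hausdorff_space B \<and> embedding_map X B e \<and>
     B closure_of (e ` topspace X) = topspace B"

definition maltsev_extension ::
    "'a topology \<Rightarrow> ('a \<Rightarrow> 'a \<Rightarrow> 'a \<Rightarrow> 'a) \<Rightarrow> 'b topology \<Rightarrow> ('a \<Rightarrow> 'b) \<Rightarrow> bool" where
  "maltsev_extension X P B e \<longleftrightarrow>
     compact_extension X B e \<and>
     (\<exists>Q. continuous_map (cube_topology B) B (\<lambda>(x, y, z). Q x y z) \<and>
          (\<forall>x\<in>topspace X. \<forall>y\<in>topspace X. \<forall>z\<in>topspace X.
             Q (e x) (e y) (e z) = e (P x y z)))"

(* Restricting the points of the extension to the type 'a set set loses no generality:
   if e is a dense embedding of X into a Hausdorff space B (over any type), then sending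
   p to the family of all sets {x. x in topspace X and e x in U}, U ranging over the open
   neighbourhoods of p, is injective on B. *)
definition precompact_maltsev :: "'a topology \<Rightarrow> ('a \<Rightarrow> 'a \<Rightarrow> 'a \<Rightarrow> 'a) \<Rightarrow> bool" where
  "precompact_maltsev X P \<longleftrightarrow>
     continuous_maltsev X P \<and>
     (\<exists>(B :: 'a set set topology) e. maltsev_extension X P B e)"

(* For precompact P the extension is unique up to a homeomorphism fixing X pointwise, so
   the choice does not matter; for other P the value is meaningless. *)
definition maltsev_completion ::
    "'a topology \<Rightarrow> ('a \<Rightarrow> 'a \<Rightarrow> 'a \<Rightarrow> 'a) \<Rightarrow> 'a set set topology" where
  "maltsev_completion X P = (SOME B. \<exists>e. maltsev_extension X P B e)"

definition precompact_strongly_rectifiable :: "'a topology \<Rightarrow> bool" where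
  "precompact_strongly_rectifiable X \<longleftrightarrow> (\<exists>P. strong_maltsev X P \<and> precompact_maltsev X P)"

(* The Cantor set, up to homeomorphism: the countable power of the two-point discrete space. *)
definition cantor_space :: "(nat \<Rightarrow> bool) topology" where
  "cantor_space = product_topology (\<lambda>_. discrete_topology UNIV) UNIV"

end

theory Submission
  imports Defs
begin

text \<open>
  A binary tree of clopen cells codes \<open>X\<close> densely into the Cantor set. If \<open>y \<noteq> z\<close> first separate
  at level \<open>n\<close>, then \<open>z\<close> lies in the sibling of the level \<open>n + 1\<close> cell of \<open>y\<close>, and \<open>P x y z\<close> is the
  image of \<open>z\<close> under a homeomorphism from that sibling to the sibling of the level \<open>n + 1\<close> cell of \<open>x\<close>.
  These homeomorphisms factor through \<open>X\<close>, so they compose, and the strong Mal'tsev law holds. If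
  they are taken from a countable clopen algebra that is invariant under them and whose members are
  all unions of cells of some level, then \<open>P\<close> is uniformly continuous with respect to the coding, and
  it extends to the Cantor set.
\<close>

text \<open>Infinitely many homeomorphisms enter the definition of \<open>P\<close>, with no common
  modulus of continuity. What tames them is the target: a split at level \<open>n\<close> puts
  \<open>P x y z\<close> into the level \<open>n\<close> cell of \<open>x\<close>, so deep splits
  move \<open>x\<close> very little and only finitely many maps matter at a given precision.

  The choices look circular, since the tree follows the algebra and the maps act between cells of
  the tree. The circle is broken by fixing a homeomorphism from \<open>X\<close> onto every nonempty
  clopen set at the outset, then closing a countable clopen base under those maps, and only then
  growing the tree.

  Since \<open>maltsev_completion\<close> is an arbitrary choice among extensions, a concrete
  extension says nothing about it until uniqueness up to homeomorphism is known. A space has many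
  compactifications in general; the Mal'tsev identities force these ones to agree.

  If \<open>X\<close> has at most one point, so has each of its compact extensions, which therefore
  cannot be the Cantor set. With two points, homogeneity excludes isolated points, so every cell can
  be split and the codes are dense.\<close>

section \<open>Countable clopen bases\<close>

lemma metrizable_separable_imp_second_countable:
  assumes "metrizable_space X" and "separable_space X"
  shows "second_countable X"
proof -
  obtain M d where "Metric_space M d" and X: "X = Metric_space.mtopology M d"
    using assms(1) by (auto simp: metrizable_space_def)
  then interpret Metric_space M d by simp
  obtain C where C: "countable C" "C \<subseteq> M" "mtopology closure_of C = M"
    using assms(2) by (auto simp: separable_space_def X)
  let ?B = "(\<lambda>(c, n). mball c (inverse (real (Suc n)))) ` (C \<times> UNIV)"
  have "\<exists>V\<in>?B. x \<in> V \<and> V \<subseteq> U" if U: "openin mtopology U" "x \<in> U" for U x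
  proof -
    have "x \<in> M"
      using U openin_subset by fastforce
    obtain r where "r > 0" and r: "mball x r \<subseteq> U"
      using U by (auto simp: openin_mtopology)
    obtain n where n: "inverse (real (Suc n)) < r / 2"
      using reals_Archimedean[of "r / 2"] \<open>r > 0\<close> by auto
    have "x \<in> mtopology closure_of C"
      using C \<open>x \<in> M\<close> by auto
    then obtain c where c: "c \<in> C" "c \<in> mball x (inverse (real (Suc n)))"
      unfolding metric_closure_of by (auto dest!: spec[of _ "inverse (real (Suc n))"])
    have "mball c (inverse (real (Suc n))) \<subseteq> mball x r"
    proof
      fix y assume "y \<in> mball c (inverse (real (Suc n)))"
      then show "y \<in> mball x r"
        using c n triangle[of x c y] by auto
    qed
    then show ?thesis
      using c r by (intro bexI[of _ "mball c (inverse (real (Suc n)))"]) (auto simp: commute)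
  qed
  then show ?thesis
    unfolding second_countable_def X using C(1)
    by (intro exI[of _ ?B]) auto
qed

text \<open>A countable base has only countably many pairs of members, so it is enough to choose one
  clopen set between each pair that admits one. Zero-dimensionality provides enough such
  pairs.\<close>

lemma countable_clopen_base:
  assumes "second_countable X" and "X dim_le 0"
  obtains \<C> where "countable \<C>" "\<And>A. A \<in> \<C> \<Longrightarrow> openin X A \<and> closedin X A"
    "\<And>U x. openin X U \<Longrightarrow> x \<in> U \<Longrightarrow> \<exists>A\<in>\<C>. x \<in> A \<and> A \<subseteq> U"
proof -
  obtain \<B> where \<B>: "countable \<B>" "\<And>V. V \<in> \<B> \<Longrightarrow> openin X V"
      "\<And>U x. openin X U \<Longrightarrow> x \<in> U \<Longrightarrow> \<exists>V\<in>\<B>. x \<in> V \<and> V \<subseteq> U"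
    using assms(1) by (auto simp: second_countable_def)
  define between where "between = (\<lambda>(U, V) A. openin X A \<and> closedin X A \<and> U \<subseteq> A \<and> A \<subseteq> V)"
  define \<C> where "\<C> = (\<lambda>p. SOME A. between p A) ` {p \<in> \<B> \<times> \<B>. Ex (between p)}"
  have some: "between p (SOME A. between p A)" if "Ex (between p)" for p
    using that by (rule someI_ex)
  show thesis
  proof (rule that)
    show "countable \<C>"
      unfolding \<C>_def using \<B>(1) by (intro countable_image countable_Collect) auto
    show "openin X A \<and> closedin X A" if "A \<in> \<C>" for A
    proof -
      have "\<exists>p. between p A"
        using that some unfolding \<C>_def by blast
      then show ?thesis
        by (auto simp: between_def)
    qed
    show "\<exists>A\<in>\<C>. x \<in> A \<and> A \<subseteq> U" if U: "openin X U" "x \<in> U" for U x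
    proof -
      obtain V where V: "V \<in> \<B>" "x \<in> V" "V \<subseteq> U"
        using \<B>(3)[OF U] by blast
      have "\<exists>U' A. openin X U' \<and> (closedin X A \<and> openin X A) \<and> x \<in> U' \<and> U' \<subseteq> A \<and> A \<subseteq> V"
        using assms(2) \<B>(2)[OF V(1)] V(2)
        unfolding dimension_le_0_neighbourhood_base_of_clopen neighbourhood_base_of by blast
      then obtain A where A: "openin X A" "closedin X A" "x \<in> A" "A \<subseteq> V"
        by blast
      obtain W where W: "W \<in> \<B>" "x \<in> W" "W \<subseteq> A"
        using \<B>(3) A by blast
      have ex: "Ex (between (W, V))"
        using A W by (auto simp: between_def)
      then have "(SOME A. between (W, V) A) \<in> \<C>"
        using V W unfolding \<C>_def by blast
      then show ?thesis
        using some[OF ex] V W unfolding between_def by blast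
    qed
  qed
qed

section \<open>Cylinders and compactness in the Cantor set\<close>

text \<open>Finite prefixes are the form in which cells of the tree will appear, so openness is
  reduced to them once and for all.\<close>

lemma openin_cantor_space:
  "openin cantor_space S \<longleftrightarrow> (\<forall>s\<in>S. \<exists>n. \<forall>t. (\<forall>i<n. t i = s i) \<longrightarrow> t \<in> S)"
    (is "?l \<longleftrightarrow> ?r")
proof
  assume ?l
  show ?r
  proof
    fix s assume "s \<in> S"
    then obtain U where fin: "finite {i. U i \<noteq> UNIV}" and U: "s \<in> Pi\<^sub>E UNIV U" "Pi\<^sub>E UNIV U \<subseteq> S"
      using \<open>?l\<close> unfolding cantor_space_def openin_product_topology_alt by (auto; meson)
    obtain n where n: "\<And>i. U i \<noteq> UNIV \<Longrightarrow> i < n"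
      using finite_nat_set_iff_bounded[of "{i. U i \<noteq> UNIV}"] fin by auto
    have "t \<in> S" if t: "\<forall>i<n. t i = s i" for t
    proof -
      have "t i \<in> U i" for i
        using t U(1) n[of i] by (cases "i < n") (auto simp: PiE_iff)
      then show ?thesis
        using U(2) by (auto simp: PiE_iff)
    qed
    then show "\<exists>n. \<forall>t. (\<forall>i<n. t i = s i) \<longrightarrow> t \<in> S"
      by blast
  qed
next
  assume ?r
  show ?l
    unfolding cantor_space_def openin_product_topology_alt
  proof
    fix s assume "s \<in> S"
    then obtain n where n: "\<And>t. (\<forall>i<n. t i = s i) \<Longrightarrow> t \<in> S"
      using \<open>?r\<close> by blast
    have "finite {i. (if i < n then {s i} else UNIV) \<noteq> UNIV}"
      by (rule finite_subset[of _ "{..<n}"]) auto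
    then show "\<exists>U. finite {i \<in> UNIV. U i \<noteq> topspace (discrete_topology UNIV)} \<and>
        (\<forall>i\<in>UNIV. openin (discrete_topology UNIV) (U i)) \<and> s \<in> Pi\<^sub>E UNIV U \<and> Pi\<^sub>E UNIV U \<subseteq> S"
      by (intro exI[of _ "\<lambda>i. if i < n then {s i} else UNIV"]) (auto simp: PiE_iff intro!: n split: if_splits)
  qed
qed

lemma topspace_cantor_space [simp]: "topspace cantor_space = UNIV"
  by (simp add: cantor_space_def)

lemma compact_Hausdorff_cantor_space: "compact_space cantor_space" "Hausdorff_space cantor_space"
  by (auto simp: cantor_space_def compact_space_product_topology Hausdorff_space_product_topology
      compact_space_discrete_topology)

section \<open>Extensions of a Mal'tsev operation and their uniqueness\<close>

text \<open>Extensions arise on convenient types, whereas \<open>precompact_maltsev\<close> asks for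
  points of type \<open>'a set set\<close>. Conjugating the extended operation by \<open>h\<close>
  moves it there.\<close>

lemma maltsev_extension_transport:
  assumes ext: "maltsev_extension X P B e" and h: "homeomorphic_map B B' h"
  shows "maltsev_extension X P B' (h \<circ> e)"
proof -
  obtain g where hg: "homeomorphic_maps B B' h g"
    using h by (auto simp: homeomorphic_map_maps)
  then have cont: "continuous_map B B' h" "continuous_map B' B g"
    and gh: "\<And>x. x \<in> topspace B \<Longrightarrow> g (h x) = x"
    by (auto simp: homeomorphic_maps_def)
  have hom: "B homeomorphic_space B'"
    using h by (rule homeomorphic_map_imp_homeomorphic_space)
  have ce: "compact_extension X B e"
    using ext by (simp add: maltsev_extension_def)
  obtain Q where Q: "continuous_map (cube_topology B) B (\<lambda>(x, y, z). Q x y z)"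
     and QP: "\<forall>x\<in>topspace X. \<forall>y\<in>topspace X. \<forall>z\<in>topspace X. Q (e x) (e y) (e z) = e (P x y z)"
    using ext by (auto simp: maltsev_extension_def)
  have e: "e ` topspace X \<subseteq> topspace B"
    using ce unfolding compact_extension_def embedding_map_def
    by (metis homeomorphic_imp_surjective_map topspace_subtopology inf_le1)
  have "compact_extension X B' (h \<circ> e)"
    unfolding compact_extension_def
  proof (intro conjI)
    show "compact_space B'" "Hausdorff_space B'"
      using ce hom homeomorphic_compact_space homeomorphic_Hausdorff_space
      by (auto simp: compact_extension_def)
    show "embedding_map X B' (h \<circ> e)"
      using ce h by (meson compact_extension_def embedding_map_compose surjective_embedding_map)
    show "B' closure_of (h \<circ> e) ` topspace X = topspace B'"
      using homeomorphic_map_closure_of[OF h e] ce homeomorphic_imp_surjective_map[OF h]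
      by (simp add: compact_extension_def image_comp)
  qed
  moreover have "continuous_map (cube_topology B') B' (\<lambda>(x, y, z). h (Q (g x) (g y) (g z)))"
  proof -
    have "continuous_map (cube_topology B') B (g \<circ> fst)"
      "continuous_map (cube_topology B') B (g \<circ> (fst \<circ> snd))"
      "continuous_map (cube_topology B') B (g \<circ> (snd \<circ> snd))"
      using continuous_map_compose[OF continuous_map_fst cont(2)]
        continuous_map_compose[OF continuous_map_compose[OF continuous_map_snd continuous_map_fst] cont(2)]
        continuous_map_compose[OF continuous_map_compose[OF continuous_map_snd continuous_map_snd] cont(2)]
      by blast+
    then have "continuous_map (cube_topology B') (cube_topology B)
        (\<lambda>p. (g (fst p), g (fst (snd p)), g (snd (snd p))))"
      by (auto intro!: continuous_map_pairedI simp: comp_def)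
    from continuous_map_compose[OF continuous_map_compose[OF this Q] cont(1)]
    show ?thesis
      by (simp add: comp_def case_prod_unfold)
  qed
  ultimately show ?thesis
    unfolding maltsev_extension_def using QP e gh
    by (intro conjI exI[of _ "\<lambda>x y z. h (Q (g x) (g y) (g z))"]) (auto simp: image_subset_iff)
qed

lemma ex_homeomorphic_copy:
  fixes Y :: "'b topology" and j :: "'b \<Rightarrow> 'c"
  assumes "inj_on j (topspace Y)"
  obtains B :: "'c topology" where "homeomorphic_map Y B j"
proof
  let ?B = "pullback_topology (j ` topspace Y) (inv_into (topspace Y) j) Y"
  have inv: "\<And>y. y \<in> topspace Y \<Longrightarrow> inv_into (topspace Y) j (j y) = y"
    using assms by simp
  have "continuous_map Y Y (inv_into (topspace Y) j \<circ> j)"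
    by (rule continuous_map_eq[OF continuous_map_id]) (simp add: inv)
  then have "continuous_map Y ?B j"
    by (rule continuous_map_pullback') auto
  moreover have "continuous_map ?B Y (inv_into (topspace Y) j)"
    using continuous_map_pullback[OF continuous_map_id, of "j ` topspace Y" "inv_into (topspace Y) j" Y]
    by simp
  ultimately show "homeomorphic_map Y ?B j"
    using inv unfolding homeomorphic_map_maps homeomorphic_maps_def
    by (intro exI[of _ "inv_into (topspace Y) j"]) (auto simp: topspace_pullback_topology)
qed

lemma embedding_map_openin_preimage:
  assumes "embedding_map X B e" and "openin X U"
  obtains W where "openin B W" "\<And>y. y \<in> topspace X \<Longrightarrow> e y \<in> W \<longleftrightarrow> y \<in> U"
proof -
  have hom: "homeomorphic_map X (subtopology B (e ` topspace X)) e"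
    using assms(1) by (simp add: embedding_map_def)
  then have "openin (subtopology B (e ` topspace X)) (e ` U)"
    using homeomorphic_map_openness[OF hom] assms(2) openin_subset by blast
  then obtain W where W: "openin B W" "e ` U = W \<inter> e ` topspace X"
    by (auto simp: openin_subtopology)
  have inj: "inj_on e (topspace X)"
    using hom homeomorphic_imp_injective_map by blast
  have "e y \<in> W \<longleftrightarrow> y \<in> U" if "y \<in> topspace X" for y
  proof -
    have "e y \<in> W \<longleftrightarrow> e y \<in> e ` U"
      unfolding W(2) using that by blast
    also have "\<dots> \<longleftrightarrow> y \<in> U"
      using inj openin_subset[OF assms(2)] that by (simp add: inj_on_image_mem_iff)
    finally show ?thesis .
  qed
  with W(1) show thesis
    by (rule that)
qed

text \<open>\<open>K\<close> plays the role of a common compact cover of both extensions. The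
  statement is asymmetric in \<open>p1\<close> and \<open>p2\<close>; exchanging them makes both
  projections homeomorphisms.\<close>

lemma maltsev_extension_projection:
  assumes P: "continuous_maltsev X P"
    and K: "compact_space K" "K closure_of (e ` topspace X) = topspace K" "e \<in> topspace X \<rightarrow> topspace K"
    and p1: "continuous_map K B1 p1" and p2: "continuous_map K B2 p2"
    and inj: "\<And>k l. k \<in> topspace K \<Longrightarrow> l \<in> topspace K \<Longrightarrow> p1 k = p1 l \<Longrightarrow> p2 k = p2 l \<Longrightarrow> k = l"
    and e1: "maltsev_extension X P B1 (p1 \<circ> e)"
    and e2: "maltsev_extension X P B2 (p2 \<circ> e)"
  shows "homeomorphic_map K B1 p1"
proof -
  define e1 where "e1 = p1 \<circ> e"
  define e2 where "e2 = p2 \<circ> e"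
  have ce: "compact_extension X B1 e1" "compact_extension X B2 e2"
    using e1 e2 by (auto simp: maltsev_extension_def e1_def e2_def)
  obtain Q1 where Q1: "continuous_map (cube_topology B1) B1 (\<lambda>(x, y, z). Q1 x y z)"
     and Q1P: "\<And>x y z. x \<in> topspace X \<Longrightarrow> y \<in> topspace X \<Longrightarrow> z \<in> topspace X \<Longrightarrow> Q1 (e1 x) (e1 y) (e1 z) = e1 (P x y z)"
    using e1 unfolding maltsev_extension_def e1_def by auto
  obtain Q2 where Q2: "continuous_map (cube_topology B2) B2 (\<lambda>(x, y, z). Q2 x y z)"
     and Q2P: "\<And>x y z. x \<in> topspace X \<Longrightarrow> y \<in> topspace X \<Longrightarrow> z \<in> topspace X \<Longrightarrow> Q2 (e2 x) (e2 y) (e2 z) = e2 (P x y z)"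
    using e2 unfolding maltsev_extension_def e2_def by auto
  have haus: "Hausdorff_space B1" "Hausdorff_space B2"
    using ce by (auto simp: compact_extension_def)
  have PX: "P x y z \<in> topspace X" if "x \<in> topspace X" "y \<in> topspace X" "z \<in> topspace X" for x y z
    using P that unfolding continuous_maltsev_def continuous_map_def by (auto simp: Pi_iff)
  have Pid: "P x y y = x" "P y y x = x" if "x \<in> topspace X" "y \<in> topspace X" for x y
    using P that unfolding continuous_maltsev_def by auto
  have cont3: "continuous_map Z Y (\<lambda>k. Q (f k) (g k) (h k))"
    if "continuous_map (cube_topology Y) Y (\<lambda>(x, y, z). Q x y z)"
      "continuous_map Z Y f" "continuous_map Z Y g" "continuous_map Z Y h"
    for Z :: "'z topology" and Y :: "'y topology" and Q f g h
  proof -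
    have "continuous_map Z (cube_topology Y) (\<lambda>k. (f k, g k, h k))"
      using that by (intro continuous_map_pairedI)
    from continuous_map_compose[OF this that(1)] show ?thesis
      by (simp add: comp_def)
  qed
  have p1K: "p1 k \<in> topspace B1" and p2K: "p2 k \<in> topspace B2" if "k \<in> topspace K" for k
    using p1 p2 that by (auto simp: continuous_map_def)
  \<comment> \<open>Each side needs a different identity: this one collapses \<open>Q1\<close> on a
    pair with equal first coordinates, its mirror image for \<open>Q2\<close> recovers
    \<open>p2 l\<close>. Both pass from \<open>X\<close> to \<open>K\<close> by density, as
    equalities of continuous maps into Hausdorff spaces.\<close>
  have Q1id: "Q1 (p1 k) (p1 l) (p1 l) = p1 k" if kl: "k \<in> topspace K" "l \<in> topspace K" for k l
  proof -
    have "(k, l) \<in> (prod_topology K K) closure_of (e ` topspace X \<times> e ` topspace X)"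
      using kl K(2) by (simp add: closure_of_Times)
    then have "(\<lambda>(k, l). Q1 (p1 k) (p1 l) (p1 l)) (k, l) = (\<lambda>(k, l). p1 k) (k, l)"
    proof (rule forall_in_closure_of_eq[OF _ haus(1)])
      have "continuous_map (prod_topology K K) B1 (\<lambda>q. p1 (fst q))" "continuous_map (prod_topology K K) B1 (\<lambda>q. p1 (snd q))"
        using continuous_map_compose[OF continuous_map_fst p1] continuous_map_compose[OF continuous_map_snd p1]
        by (auto simp: comp_def)
      then show "continuous_map (prod_topology K K) B1 (\<lambda>(k, l). Q1 (p1 k) (p1 l) (p1 l))"
        "continuous_map (prod_topology K K) B1 (\<lambda>(k, l). p1 k)"
        using cont3[OF Q1] by (auto simp: case_prod_unfold)
    next
      fix q assume "q \<in> e ` topspace X \<times> e ` topspace X"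
      then show "(\<lambda>(k, l). Q1 (p1 k) (p1 l) (p1 l)) q = (\<lambda>(k, l). p1 k) q"
        using Q1P Pid by (auto simp: e1_def)
    qed
    then show ?thesis
      by simp
  qed
  have Q2id: "Q2 (p2 k) (p2 k) (p2 l) = p2 l" if kl: "k \<in> topspace K" "l \<in> topspace K" for k l
  proof -
    have "(k, l) \<in> (prod_topology K K) closure_of (e ` topspace X \<times> e ` topspace X)"
      using kl K(2) by (simp add: closure_of_Times)
    then have "(\<lambda>(k, l). Q2 (p2 k) (p2 k) (p2 l)) (k, l) = (\<lambda>(k, l). p2 l) (k, l)"
    proof (rule forall_in_closure_of_eq[OF _ haus(2)])
      have "continuous_map (prod_topology K K) B2 (\<lambda>q. p2 (fst q))" "continuous_map (prod_topology K K) B2 (\<lambda>q. p2 (snd q))"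
        using continuous_map_compose[OF continuous_map_fst p2] continuous_map_compose[OF continuous_map_snd p2]
        by (auto simp: comp_def)
      then show "continuous_map (prod_topology K K) B2 (\<lambda>(k, l). Q2 (p2 k) (p2 k) (p2 l))"
        "continuous_map (prod_topology K K) B2 (\<lambda>(k, l). p2 l)"
        using cont3[OF Q2] by (auto simp: case_prod_unfold)
    next
      fix q assume "q \<in> e ` topspace X \<times> e ` topspace X"
      then show "(\<lambda>(k, l). Q2 (p2 k) (p2 k) (p2 l)) q = (\<lambda>(k, l). p2 l) q"
        using Q2P Pid by (auto simp: e2_def)
    qed
    then show ?thesis
      by simp
  qed
  \<comment> \<open>Over points of \<open>X\<close> the fibres of \<open>p1\<close> are singletons; for \<open>p1 k = p1 l\<close> the operations move this
    to \<open>Q2 (p2 m) (p2 k) (p2 l) = p2 m\<close> for \<open>m\<close> in \<open>X\<close>, then for all \<open>m\<close> by density, and \<open>m = k\<close> gives \<open>p2 k = p2 l\<close>.\<close>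
  have fibre: "p2 k = e2 x" if k: "k \<in> topspace K" and x: "x \<in> topspace X" and eq: "p1 k = e1 x" for k x
  proof (rule ccontr)
    assume "p2 k \<noteq> e2 x"
    moreover have "e2 x \<in> topspace B2"
      using K(3) p2K x by (auto simp: e2_def)
    ultimately obtain U V where UV: "openin B2 U" "openin B2 V" "p2 k \<in> U" "e2 x \<in> V" "disjnt U V"
      using haus(2) p2K[OF k] unfolding Hausdorff_space_def by metis
    have emb: "embedding_map X B1 e1" "embedding_map X B2 e2"
      using ce by (auto simp: compact_extension_def)
    have "continuous_map X B2 e2"
      using emb(2) unfolding embedding_map_def
      by (meson continuous_map_into_fulltopology homeomorphic_imp_continuous_map)
    then have "openin X {y \<in> topspace X. e2 y \<in> V}"
      using UV(2) by (rule openin_continuous_map_preimage)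
    then obtain W where W: "openin B1 W"
      "\<And>y. y \<in> topspace X \<Longrightarrow> e1 y \<in> W \<longleftrightarrow> y \<in> {y \<in> topspace X. e2 y \<in> V}"
      using embedding_map_openin_preimage[OF emb(1)] by blast
    \<comment> \<open>On points of \<open>X\<close>, \<open>W\<close> tests through
      \<open>e1\<close> what \<open>V\<close> tests through \<open>e2\<close>. A point of
      \<open>X\<close> in this neighbourhood of \<open>k\<close> would have its second coordinate in
      both \<open>U\<close> and \<open>V\<close>.\<close>
    let ?N = "{l \<in> topspace K. p1 l \<in> W} \<inter> {l \<in> topspace K. p2 l \<in> U}"
    have open_N: "openin K ?N"
      using openin_continuous_map_preimage[OF p1 W(1)] openin_continuous_map_preimage[OF p2 UV(1)]
      by (rule openin_Int)
    have k_N: "k \<in> ?N"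
      using k eq W(2)[OF x] x UV by simp
    have "k \<in> K closure_of (e ` topspace X)"
      using K(2) k by simp
    then have "\<forall>T. k \<in> T \<and> openin K T \<longrightarrow> (\<exists>l. l \<in> e ` topspace X \<and> l \<in> T)"
      by (auto simp: in_closure_of)
    then have "\<exists>l. l \<in> e ` topspace X \<and> l \<in> ?N"
      using open_N k_N by (elim allE[of _ ?N] mp) (rule conjI)
    then obtain y where "y \<in> topspace X" "e y \<in> ?N"
      by blast
    then show False
      using W(2)[of y] UV(5) by (auto simp: e1_def e2_def disjnt_iff)
  qed
  \<comment> \<open>The image of \<open>K\<close> in the product is a subalgebra: it is compact,
    hence closed, and it contains the values at triples from \<open>X\<close>, which are
    dense.\<close>
  have sub: "\<exists>k\<in>topspace K. p1 k = Q1 (p1 k1) (p1 k2) (p1 k3) \<and> p2 k = Q2 (p2 k1) (p2 k2) (p2 k3)"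
    if k: "k1 \<in> topspace K" "k2 \<in> topspace K" "k3 \<in> topspace K" for k1 k2 k3
  proof -
    let ?p = "\<lambda>k. (p1 k, p2 k)"
    let ?Q = "\<lambda>(k1, k2, k3). (Q1 (p1 k1) (p1 k2) (p1 k3), Q2 (p2 k1) (p2 k2) (p2 k3))"
    have "compactin (prod_topology B1 B2) (?p ` topspace K)"
      using K(1) p1 p2 by (intro image_compactin[of K] continuous_map_pairedI) (auto simp: compact_space_def)
    then have closed: "closedin (prod_topology B1 B2) (?p ` topspace K)"
      using haus by (intro compactin_imp_closedin) (auto simp: Hausdorff_space_prod_topology)
    have fst3: "continuous_map (cube_topology K) K fst" "continuous_map (cube_topology K) K (\<lambda>q. fst (snd q))"
      "continuous_map (cube_topology K) K (\<lambda>q. snd (snd q))"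
      using continuous_map_fst continuous_map_compose[OF continuous_map_snd continuous_map_fst]
        continuous_map_compose[OF continuous_map_snd continuous_map_snd]
      by (auto simp: comp_def)
    have pr: "continuous_map (cube_topology K) Y (\<lambda>q. p (fst q))"
      "continuous_map (cube_topology K) Y (\<lambda>q. p (fst (snd q)))"
      "continuous_map (cube_topology K) Y (\<lambda>q. p (snd (snd q)))"
      if "continuous_map K Y p" for p and Y :: "'y topology"
      using fst3[THEN continuous_map_compose, OF that] by (simp_all add: comp_def)
    have "continuous_map (cube_topology K) (prod_topology B1 B2) ?Q"
      unfolding case_prod_unfold
      by (rule continuous_map_pairedI[OF cont3[OF Q1 pr[OF p1]] cont3[OF Q2 pr[OF p2]]])
    from closedin_continuous_map_preimage[OF this closed]
    have "closedin (cube_topology K) {q \<in> topspace (cube_topology K). ?Q q \<in> ?p ` topspace K}" .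
    moreover have "(k1, k2, k3) \<in> (cube_topology K) closure_of (e ` topspace X \<times> e ` topspace X \<times> e ` topspace X)"
      using k K(2) by (simp add: closure_of_Times)
    moreover have "?Q q \<in> ?p ` topspace K" if q: "q \<in> e ` topspace X \<times> e ` topspace X \<times> e ` topspace X" for q
    proof -
      obtain x y z where "x \<in> topspace X" "y \<in> topspace X" "z \<in> topspace X" "q = (e x, e y, e z)"
        using q by auto
      then have "?Q q = ?p (e (P x y z))" "P x y z \<in> topspace X"
        using Q1P Q2P PX by (auto simp: e1_def e2_def)
      then show ?thesis
        using K(3) by blast
    qed
    ultimately have "?Q (k1, k2, k3) \<in> ?p ` topspace K"
      by (rule forall_in_closure_of[rotated 2])
    then show ?thesis
      by auto
  qed
  have inj1: "inj_on p1 (topspace K)"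
  proof (rule inj_onI)
    fix k l assume kl: "k \<in> topspace K" "l \<in> topspace K" "p1 k = p1 l"
    have "Q2 (p2 m) (p2 k) (p2 l) = p2 m" if m: "m \<in> topspace K" for m
    proof (rule forall_in_closure_of_eq[where X = K and S = "e ` topspace X" and Y = B2
          and f = "\<lambda>m. Q2 (p2 m) (p2 k) (p2 l)"])
      show "m \<in> K closure_of e ` topspace X"
        using K(2) m by simp
      show "continuous_map K B2 (\<lambda>m. Q2 (p2 m) (p2 k) (p2 l))"
        using kl p2K by (intro cont3[OF Q2] p2) auto
      show "Q2 (p2 n) (p2 k) (p2 l) = p2 n" if n_in: "n \<in> e ` topspace X" for n
      proof -
        obtain x where x: "x \<in> topspace X" "n = e x"
          using n_in by blast
        then have n: "n \<in> topspace K"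
          using K(3) by auto
        obtain q where q: "q \<in> topspace K" "p1 q = Q1 (p1 n) (p1 k) (p1 l)" "p2 q = Q2 (p2 n) (p2 k) (p2 l)"
          using sub[OF n kl(1,2)] by blast
        have "p1 q = e1 x"
          using q(2) Q1id[OF n kl(2)] kl(3) x by (simp add: e1_def)
        then show ?thesis
          using fibre[OF q(1) x(1)] q(3) x by (simp add: e2_def)
      qed
    qed (use haus p2 in auto)
    from this[OF kl(1)] have "p2 k = p2 l"
      using Q2id kl by simp
    then show "k = l"
      using inj kl by blast
  qed
  have "closedin B1 (p1 ` topspace K)"
    using K(1) p1 haus by (intro compactin_imp_closedin image_compactin[of K]) (auto simp: compact_space_def)
  moreover have "e1 ` topspace X \<subseteq> p1 ` topspace K"
    using K(3) by (auto simp: e1_def)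
  ultimately have "B1 closure_of (e1 ` topspace X) \<subseteq> p1 ` topspace K"
    by (intro closure_of_minimal)
  then have "p1 ` topspace K = topspace B1"
    using ce(1) p1K by (auto simp: compact_extension_def)
  then show ?thesis
    using p1 K(1) haus(1) inj1 by (intro continuous_imp_homeomorphic_map)
qed

text \<open>The witness is the closure of the diagonal copy of \<^term>\<open>X\<close> in the product of the two extensions.\<close>
lemma maltsev_extension_unique:
  assumes "continuous_maltsev X P" and "maltsev_extension X P B1 e1" and "maltsev_extension X P B2 e2"
  shows "B1 homeomorphic_space B2"
proof -
  let ?B = "prod_topology B1 B2"
  let ?e = "\<lambda>x. (e1 x, e2 x)"
  define C where "C = ?B closure_of (?e ` topspace X)"
  let ?K = "subtopology ?B C"
  have ce: "compact_extension X B1 e1" "compact_extension X B2 e2"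
    using assms by (auto simp: maltsev_extension_def)
  have "e1 ` topspace X \<subseteq> topspace B1" "e2 ` topspace X \<subseteq> topspace B2"
    using ce unfolding compact_extension_def embedding_map_def
    by (metis homeomorphic_imp_surjective_map topspace_subtopology inf_le1)+
  then have eB: "?e ` topspace X \<subseteq> topspace ?B"
    by auto
  have topK: "topspace ?K = C"
    unfolding C_def using closure_of_subset_topspace by (metis topspace_subtopology_subset)
  have sub: "?e ` topspace X \<subseteq> C"
    unfolding C_def using eB by (rule closure_of_subset)
  have comp: "compact_space ?K"
    using ce unfolding compact_extension_def C_def
    by (simp add: closedin_compact_space compact_space_prod_topology compact_space_subtopology)
  have dense: "?K closure_of (?e ` topspace X) = topspace ?K"
    unfolding topK using sub by (simp add: closure_of_subtopology C_def inf.absorb2)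
  have "homeomorphic_map ?K B1 fst"
    using assms comp dense sub topK
    by (intro maltsev_extension_projection[where e = ?e and ?p2.0 = snd and ?B2.0 = B2 and X = X and P = P])
      (auto simp: comp_def continuous_map_fst continuous_map_snd continuous_map_from_subtopology prod_eq_iff)
  moreover have "homeomorphic_map ?K B2 snd"
    using assms comp dense sub topK
    by (intro maltsev_extension_projection[where e = ?e and ?p2.0 = fst and ?B2.0 = B1 and X = X and P = P])
      (auto simp: comp_def continuous_map_fst continuous_map_snd continuous_map_from_subtopology prod_eq_iff)
  ultimately show ?thesis
    by (meson homeomorphic_map_imp_homeomorphic_space homeomorphic_space_sym homeomorphic_space_trans)
qed

section \<open>The binary tree of clopen cells\<close>

text \<open>Countability of the algebra enters as the enumeration \<open>b\<close>, whose
  \<open>n\<close>-th member governs the cut at level \<open>n\<close>. Closure under images and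
  preimages by \<open>F\<close> suffices for all maps between members, since preimages under
  \<open>G A\<close> of subsets of \<open>X\<close> are images under \<open>F A\<close>.\<close>

locale clopen_splitting =
  fixes X :: "'a topology" and \<C> :: "'a set set" and b :: "nat \<Rightarrow> 'a set"
    and F G :: "'a set \<Rightarrow> 'a \<Rightarrow> 'a"
  assumes Hausdorff: "Hausdorff_space X" and nonempty: "topspace X \<noteq> {}"
    and clopen: "A \<in> \<C> \<Longrightarrow> openin X A \<and> closedin X A"
    and topspace_mem: "topspace X \<in> \<C>"
    and Diff_mem: "A \<in> \<C> \<Longrightarrow> B \<in> \<C> \<Longrightarrow> A - B \<in> \<C>"
    and range_b: "range b = \<C>"
    and base: "openin X U \<Longrightarrow> x \<in> U \<Longrightarrow> \<exists>A\<in>\<C>. x \<in> A \<and> A \<subseteq> U"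
    and proper_part: "A \<in> \<C> \<Longrightarrow> A \<noteq> {} \<Longrightarrow> \<exists>B\<in>\<C>. B \<subset> A \<and> B \<noteq> {}"
    and homeo: "A \<in> \<C> \<Longrightarrow> A \<noteq> {} \<Longrightarrow> homeomorphic_maps X (subtopology X A) (F A) (G A)"
    and image_mem: "A \<in> \<C> \<Longrightarrow> A \<noteq> {} \<Longrightarrow> B \<in> \<C> \<Longrightarrow> F A ` B \<in> \<C>"
    and preimage_mem: "A \<in> \<C> \<Longrightarrow> A \<noteq> {} \<Longrightarrow> B \<in> \<C> \<Longrightarrow> {x \<in> topspace X. F A x \<in> B} \<in> \<C>"
begin

lemma subset_topspace: "A \<in> \<C> \<Longrightarrow> A \<subseteq> topspace X"
  using clopen openin_subset by blast

lemma Int_mem: "A \<in> \<C> \<Longrightarrow> B \<in> \<C> \<Longrightarrow> A \<inter> B \<in> \<C>"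
  by (metis Diff_Diff_Int Diff_mem)

lemma b_mem: "b n \<in> \<C>"
  using range_b by blast

text \<open>Cutting cells of level \<open>n\<close> along \<open>b n\<close> whenever possible makes \<open>b n\<close> a union of cells of level \<open>n + 1\<close>;
  the other cells are cut somewhere else so that every finite code is attained.\<close>
definition half :: "nat \<Rightarrow> 'a set \<Rightarrow> 'a set" where
  "half n K = (if K \<inter> b n \<noteq> {} \<and> K - b n \<noteq> {} then K \<inter> b n
               else SOME B. B \<in> \<C> \<and> B \<subset> K \<and> B \<noteq> {})"

lemma half:
  assumes "K \<in> \<C>" "K \<noteq> {}"
  shows "half n K \<in> \<C>" "half n K \<subset> K" "half n K \<noteq> {}"
proof -
  have "\<exists>B. B \<in> \<C> \<and> B \<subset> K \<and> B \<noteq> {}"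
    using proper_part[OF assms] by blast
  from someI_ex[OF this] Int_mem[OF assms(1) b_mem, of n]
  have "half n K \<in> \<C> \<and> half n K \<subset> K \<and> half n K \<noteq> {}"
    unfolding half_def by auto
  then show "half n K \<in> \<C>" "half n K \<subset> K" "half n K \<noteq> {}"
    by auto
qed

text \<open>Cells are addressed by a point inside them instead of a binary word, so every cell is
  nonempty by construction.\<close>

primrec cell :: "nat \<Rightarrow> 'a \<Rightarrow> 'a set" where
  "cell 0 x = topspace X"
| "cell (Suc n) x = (if x \<in> half n (cell n x) then half n (cell n x) else cell n x - half n (cell n x))"

definition sibling :: "nat \<Rightarrow> 'a \<Rightarrow> 'a set" where
  "sibling n x = cell n x - cell (Suc n) x"

definition code :: "'a \<Rightarrow> nat \<Rightarrow> bool" where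
  "code x n \<longleftrightarrow> x \<in> half n (cell n x)"

lemma cell:
  assumes "x \<in> topspace X" 
  shows mem_cell: "x \<in> cell n x" and cell_mem: "cell n x \<in> \<C>"
proof -
  have "x \<in> cell n x \<and> cell n x \<in> \<C>"
  proof (induction n)
    case 0
    then show ?case
      using assms topspace_mem by simp
  next
    case (Suc n)
    then have "half n (cell n x) \<in> \<C>"
      by (intro half) auto
    then show ?case
      using Suc Diff_mem by simp
  qed
  then show "x \<in> cell n x" "cell n x \<in> \<C>"
    by auto
qed

lemma cell_subset_topspace: "x \<in> topspace X \<Longrightarrow> cell n x \<subseteq> topspace X"
  using cell_mem subset_topspace by blast

lemma cell_Suc_subset: "x \<in> topspace X \<Longrightarrow> cell (Suc n) x \<subseteq> cell n x"
  using half(2)[OF cell_mem[of x n], of n] mem_cell[of x n] by auto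

lemma cell_antimono: "x \<in> topspace X \<Longrightarrow> m \<le> n \<Longrightarrow> cell n x \<subseteq> cell m x"
  by (rule lift_Suc_antimono_le[of "\<lambda>n. cell n x"]) (use cell_Suc_subset in blast)

lemma cell_eq: "x \<in> topspace X \<Longrightarrow> y \<in> cell n x \<Longrightarrow> cell n y = cell n x"
proof (induction n)
  case (Suc n)
  then have "cell n y = cell n x"
    using cell_Suc_subset by blast
  then show ?case
    using Suc.prems by (auto split: if_splits)
qed simp

text \<open>The dictionary between cells of \<open>X\<close> and cylinders of the Cantor
  set.\<close>

lemma mem_cell_iff_code:
  assumes "x \<in> topspace X" "y \<in> topspace X"
  shows "y \<in> cell n x \<longleftrightarrow> (\<forall>i<n. code y i = code x i)"
proof (induction n)
  case (Suc n)
  have "y \<in> cell (Suc n) x \<longleftrightarrow> y \<in> cell n x \<and> code y n = code x n"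
  proof (cases "y \<in> cell n x")
    case True
    then show ?thesis
      using cell_eq[OF assms(1) True] by (auto simp: code_def)
  next
    case False
    then show ?thesis
      using cell_Suc_subset[OF assms(1)] by blast
  qed
  then show ?case
    by (auto simp: Suc less_Suc_eq)
qed (use assms in simp)

lemma sibling:
  assumes "x \<in> topspace X"
  shows sibling_mem: "sibling n x \<in> \<C>" and sibling_nonempty: "sibling n x \<noteq> {}"
proof -
  show "sibling n x \<in> \<C>"
    unfolding sibling_def using assms by (intro Diff_mem cell_mem)
  have "cell n x \<noteq> {}"
    using mem_cell assms by blast
  then show "sibling n x \<noteq> {}"
    using half[OF cell_mem[OF assms], of n n] unfolding sibling_def by auto
qed

text \<open>This local constancy lets one pair of homeomorphisms serve all nearby \<open>x\<close>
  and \<open>y\<close>.\<close>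

lemma sibling_eq: "x \<in> topspace X \<Longrightarrow> y \<in> cell (Suc n) x \<Longrightarrow> sibling n y = sibling n x"
  using cell_eq[of x y n] cell_eq[of x y "Suc n"] cell_Suc_subset[of x n]
  by (auto simp: sibling_def simp del: cell.simps)

text \<open>A wrong bit \<open>n\<close> is corrected by moving to the sibling, which is never empty
  and keeps the earlier bits. This yields density in the whole Cantor set and not merely in a closed
  subset.\<close>

lemma exists_code_prefix: "\<exists>x\<in>topspace X. \<forall>i<n. code x i = s i"
proof (induction n)
  case 0
  have "\<exists>x. x \<in> topspace X"
    using nonempty by blast
  then show ?case
    by blast
next
  case (Suc n)
  then obtain x where x: "x \<in> topspace X" "\<forall>i<n. code x i = s i"
    by blast
  obtain y where y: "y \<in> sibling n x"
    using sibling_nonempty[OF x(1)] by blast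
  then have yX: "y \<in> topspace X"
    using sibling_mem subset_topspace x by blast
  have "\<forall>i<n. code y i = code x i" "code y n \<noteq> code x n"
    using y mem_cell_iff_code[OF x(1) yX, of n] mem_cell_iff_code[OF x(1) yX, of "Suc n"]
    unfolding sibling_def by (auto simp: less_Suc_eq)
  then show ?case
    using x yX by (cases "code x n = s n") (auto simp: less_Suc_eq)
qed

lemma finite_cells: "finite (cell n ` topspace X)"
proof (induction n)
  case (Suc n)
  have "cell (Suc n) ` topspace X \<subseteq> half n ` cell n ` topspace X \<union> (\<lambda>K. K - half n K) ` cell n ` topspace X"
    by auto
  then show ?case
    using Suc finite_subset by blast
qed (use finite_subset in \<open>auto simp: image_constant_conv\<close>)

text \<open>For \<open>A = b k\<close>, level \<open>k + 1\<close> decides: a cell of level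
  \<open>k\<close> meeting both \<open>A\<close> and its complement is cut exactly along
  \<open>A\<close>, and any other cell already lies on one side.\<close>

lemma cell_decides:
  assumes "A \<in> \<C>"
  obtains k where "\<And>n x y. n \<ge> k \<Longrightarrow> x \<in> topspace X \<Longrightarrow> y \<in> cell n x \<Longrightarrow> y \<in> A \<longleftrightarrow> x \<in> A"
proof -
  obtain k where A: "A = b k"
    using assms range_b by blast
  have dec: "cell (Suc k) x \<subseteq> A \<or> cell (Suc k) x \<inter> A = {}" if x: "x \<in> topspace X" for x
  proof (cases "cell k x \<inter> b k \<noteq> {} \<and> cell k x - b k \<noteq> {}")
    case True
    then show ?thesis
      by (auto simp: half_def A)
  next
    case False
    then show ?thesis
      using cell_Suc_subset[OF x] A by blast
  qed
  show thesis
  proof (rule that)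
    fix n x y assume "n \<ge> Suc k" "x \<in> topspace X" "y \<in> cell n x"
    then show "y \<in> A \<longleftrightarrow> x \<in> A"
      using dec[of x] mem_cell[of x "Suc k"] cell_antimono[of x "Suc k" n] by blast
  qed
qed

lemma cell_base:
  assumes "openin X U" "x \<in> U"
  obtains n where "cell n x \<subseteq> U"
proof -
  have x: "x \<in> topspace X"
    using assms openin_subset by blast
  obtain A where A: "A \<in> \<C>" "x \<in> A" "A \<subseteq> U"
    using base[OF assms] by blast
  obtain k where "\<And>n x y. n \<ge> k \<Longrightarrow> x \<in> topspace X \<Longrightarrow> y \<in> cell n x \<Longrightarrow> y \<in> A \<longleftrightarrow> x \<in> A"
    using cell_decides[OF A(1)] by blast
  from this[of k x] have "cell k x \<subseteq> U"
    using A x by blast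
  then show thesis
    by (rule that)
qed

lemma exists_separating_cell:
  assumes "x \<in> topspace X" "y \<in> topspace X" "x \<noteq> y"
  shows "\<exists>n. y \<notin> cell n x"
proof -
  obtain U V where "openin X U" "x \<in> U" "y \<in> V" "disjnt U V"
    using Hausdorff assms unfolding Hausdorff_space_def by metis
  moreover then obtain n where "cell n x \<subseteq> U"
    using cell_base by metis
  ultimately show ?thesis
    by (auto simp: disjnt_iff)
qed

section \<open>The Mal'tsev operation and its laws\<close>

text \<open>Level 0 is all of \<open>X\<close> and separates nothing; the shift by one makes the
  value agree with the index of \<open>sibling\<close>. No level separates \<open>y\<close> from
  itself, hence the separate clause for \<open>y = z\<close> in \<open>maltsev\<close>.\<close>

definition split_level :: "'a \<Rightarrow> 'a \<Rightarrow> nat" where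
  "split_level y z = (LEAST n. z \<notin> cell (Suc n) y)"

lemma split_level_eq:
  assumes "y \<in> topspace X" "z \<in> sibling n y"
  shows "split_level y z = n"
  unfolding split_level_def
proof (rule Least_equality)
  show "z \<notin> cell (Suc n) y"
    using assms(2) by (simp add: sibling_def del: cell.simps)
  show "n \<le> m" if "z \<notin> cell (Suc m) y" for m
  proof (rule ccontr)
    assume "\<not> n \<le> m"
    then have "cell n y \<subseteq> cell (Suc m) y"
      using assms(1) by (intro cell_antimono) auto
    then show False
      using that assms(2) by (auto simp: sibling_def simp del: cell.simps)
  qed
qed

lemma exists_sibling:
  assumes "y \<in> topspace X" "z \<in> topspace X" "y \<noteq> z"
  obtains n where "z \<in> sibling n y"
proof -
  define n where "n = (LEAST n. z \<notin> cell n y)"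
  have n: "z \<notin> cell n y"
    unfolding n_def by (rule LeastI_ex[OF exists_separating_cell[OF assms]])
  obtain m where m: "n = Suc m"
    using n assms by (cases n) auto
  have "z \<in> cell m y"
    using not_less_Least[of m "\<lambda>n. z \<notin> cell n y"] m unfolding n_def by auto
  then have "z \<in> sibling m y"
    using n m by (simp add: sibling_def del: cell.simps)
  then show thesis
    by (rule that)
qed

definition maltsev :: "'a \<Rightarrow> 'a \<Rightarrow> 'a \<Rightarrow> 'a" where
  "maltsev x y z = (if y = z then x
     else F (sibling (split_level y z) x) (G (sibling (split_level y z) y) z))"

lemma maltsev_eq:
  assumes "y \<in> topspace X" "z \<in> sibling n y"
  shows "maltsev x y z = F (sibling n x) (G (sibling n y) z)"
proof -
  have "y \<noteq> z"
    using assms mem_cell[of y "Suc n"] by (auto simp: sibling_def simp del: cell.simps)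
  then show ?thesis
    unfolding maltsev_def split_level_eq[OF assms] by simp
qed

lemma F_G:
  assumes "A \<in> \<C>" "A \<noteq> {}"
  shows "x \<in> topspace X \<Longrightarrow> F A x \<in> A" "x \<in> topspace X \<Longrightarrow> G A (F A x) = x"
    "x \<in> A \<Longrightarrow> G A x \<in> topspace X" "x \<in> A \<Longrightarrow> F A (G A x) = x"
proof -
  have "topspace (subtopology X A) = A"
    using subset_topspace[OF assms(1)] by auto
  then have "F A \<in> topspace X \<rightarrow> A" "G A \<in> A \<rightarrow> topspace X"
    "\<And>x. x \<in> topspace X \<Longrightarrow> G A (F A x) = x" "\<And>x. x \<in> A \<Longrightarrow> F A (G A x) = x"
    using homeo[OF assms] unfolding homeomorphic_maps_def continuous_map_def by metis+
  then show "x \<in> topspace X \<Longrightarrow> F A x \<in> A" "x \<in> topspace X \<Longrightarrow> G A (F A x) = x"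
    "x \<in> A \<Longrightarrow> G A x \<in> topspace X" "x \<in> A \<Longrightarrow> F A (G A x) = x"
    by auto
qed

text \<open>The splitting level is preserved: \<open>x\<close> and the value split where
  \<open>y\<close> and \<open>z\<close> do. Nested terms can therefore be evaluated with a single
  \<open>n\<close>.\<close>

lemma maltsev_sibling:
  assumes "x \<in> topspace X" "y \<in> topspace X" "z \<in> sibling n y"
  shows "maltsev x y z \<in> sibling n x"
  unfolding maltsev_eq[OF assms(2,3)]
  using assms sibling by (intro F_G) auto

lemma maltsev_topspace:
  assumes "x \<in> topspace X" "y \<in> topspace X" "z \<in> topspace X"
  shows "maltsev x y z \<in> topspace X"
proof (cases "y = z")
  case True
  then show ?thesis
    using assms by (simp add: maltsev_def)
next
  case False
  then obtain n where "z \<in> sibling n y"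
    using exists_sibling assms by blast
  from maltsev_sibling[OF assms(1,2) this] show ?thesis
    using sibling_mem[OF assms(1)] subset_topspace by blast
qed

lemma maltsev_laws:
  assumes "x \<in> topspace X" "y \<in> topspace X"
  shows "maltsev x y y = x" "maltsev y y x = x"
proof -
  show "maltsev x y y = x"
    by (simp add: maltsev_def)
  show "maltsev y y x = x"
  proof (cases "y = x")
    case True
    then show ?thesis
      by (simp add: maltsev_def)
  next
    case False
    then obtain n where n: "x \<in> sibling n y"
      using exists_sibling assms by blast
    then show ?thesis
      using F_G(4)[OF sibling[OF assms(2)]] maltsev_eq[OF assms(2)] by simp
  qed
qed

text \<open>The inner value lies in \<open>sibling n y\<close>, so the outer operation applies
  \<open>G (sibling n y)\<close> and cancels the \<open>F (sibling n y)\<close> of the inner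
  one.\<close>

lemma maltsev_strong:
  assumes "x \<in> topspace X" "y \<in> topspace X" "z \<in> topspace X" "u \<in> topspace X"
  shows "maltsev x y (maltsev y z u) = maltsev x z u"
proof (cases "z = u")
  case True
  then show ?thesis
    by (simp add: maltsev_def)
next
  case False
  then obtain n where n: "u \<in> sibling n z"
    using exists_sibling assms by blast
  have "maltsev x y (maltsev y z u) = F (sibling n x) (G (sibling n y) (maltsev y z u))"
    using assms(2) maltsev_sibling[OF assms(2,3) n] by (rule maltsev_eq)
  also have "\<dots> = F (sibling n x) (G (sibling n z) u)"
    unfolding maltsev_eq[OF assms(3) n] using assms n F_G[OF sibling[of z n]] F_G[OF sibling[of y n]] by simp
  also have "\<dots> = maltsev x z u"
    using maltsev_eq[OF assms(3) n] by simp
  finally show ?thesis .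
qed

section \<open>Uniform continuity with respect to the cells\<close>

text \<open>Preimages of cells under the map from \<open>B\<close> to \<open>A\<close> belong to the
  algebra, so each is decided at some level. Only finitely many cells of level \<open>m\<close>
  occur, and a maximum of these levels serves all of them.\<close>

lemma homeo_uniformly_continuous:
  assumes A: "A \<in> \<C>" "A \<noteq> {}" and B: "B \<in> \<C>" "B \<noteq> {}"
  shows "\<exists>k. \<forall>n\<ge>k. \<forall>z\<in>B. \<forall>z'\<in>B. z' \<in> cell n z \<longrightarrow> F A (G B z') \<in> cell m (F A (G B z))"
proof -
  \<comment> \<open>The preimage of \<open>K\<close> under \<open>F A\<close> after
    \<open>G B\<close>, written with \<open>F\<close> alone so that \<open>preimage_mem\<close> and
    \<open>image_mem\<close> apply.\<close>
  define T where "T K = F B ` {x \<in> topspace X. F A x \<in> K}" for K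
  have T_iff: "F A (G B z) \<in> K \<longleftrightarrow> z \<in> T K" if "z \<in> B" for z K
  proof
    assume "F A (G B z) \<in> K"
    then show "z \<in> T K"
      unfolding T_def using F_G[OF B] that by (intro image_eqI[of _ _ "G B z"]) auto
  next
    assume "z \<in> T K"
    then show "F A (G B z) \<in> K"
      unfolding T_def using F_G[OF B] by auto
  qed
  have "\<forall>K\<in>cell m ` topspace X. \<exists>k. \<forall>n\<ge>k. \<forall>x\<in>topspace X. \<forall>y\<in>cell n x. y \<in> T K \<longleftrightarrow> x \<in> T K"
  proof
    fix K assume "K \<in> cell m ` topspace X"
    then have "T K \<in> \<C>"
      unfolding T_def using A B cell_mem by (intro image_mem preimage_mem) auto
    from cell_decides[OF this] show "\<exists>k. \<forall>n\<ge>k. \<forall>x\<in>topspace X. \<forall>y\<in>cell n x. y \<in> T K \<longleftrightarrow> x \<in> T K"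
      by metis
  qed
  then obtain k where k: "\<And>K n x y. K \<in> cell m ` topspace X \<Longrightarrow> n \<ge> k K \<Longrightarrow> x \<in> topspace X \<Longrightarrow>
      y \<in> cell n x \<Longrightarrow> y \<in> T K \<longleftrightarrow> x \<in> T K"
    by metis
  have "F A (G B z') \<in> cell m (F A (G B z))"
    if n: "n \<ge> Max (k ` cell m ` topspace X)" and z: "z \<in> B" "z' \<in> B" "z' \<in> cell n z" for n z z'
  proof -
    have w: "F A (G B z) \<in> topspace X"
      using F_G(1)[OF A F_G(3)[OF B z(1)]] subset_topspace[OF A(1)] by blast
    then have K: "cell m (F A (G B z)) \<in> cell m ` topspace X"
      by blast
    have "k (cell m (F A (G B z))) \<le> n"
      using finite_cells K n by (meson Max_ge finite_imageI image_eqI order_trans)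
    from k[OF K this _ z(3)] show ?thesis
      using T_iff[OF z(1)] T_iff[OF z(2)] mem_cell[OF w] z(1) subset_topspace[OF B(1)] by blast
  qed
  then show ?thesis
    by blast
qed

lemma maltsev_uniformly_continuous:
  "\<exists>N. \<forall>x\<in>topspace X. \<forall>y\<in>topspace X. \<forall>z\<in>topspace X. \<forall>x'\<in>cell N x. \<forall>y'\<in>cell N y. \<forall>z'\<in>cell N z.
    maltsev x' y' z' \<in> cell m (maltsev x y z)"
proof -
  let ?S = "(\<Union>n<m. sibling n ` topspace X)"
  have "sibling n ` topspace X \<subseteq> (\<lambda>(K, L). K - L) ` (cell n ` topspace X \<times> cell (Suc n) ` topspace X)" for n
    unfolding sibling_def by (auto simp del: cell.simps)
  then have "finite (sibling n ` topspace X)" for n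
    using finite_cells by (meson finite_SigmaI finite_imageI finite_subset)
  then have fin: "finite ?S"
    by blast
  have S: "A \<in> \<C>" "A \<noteq> {}" if "A \<in> ?S" for A
    using that sibling by auto
  have "\<forall>A B. A \<in> ?S \<and> B \<in> ?S \<longrightarrow>
      (\<exists>k. \<forall>n\<ge>k. \<forall>z\<in>B. \<forall>z'\<in>B. z' \<in> cell n z \<longrightarrow> F A (G B z') \<in> cell m (F A (G B z)))"
    by (intro allI impI homeo_uniformly_continuous) (use S in blast)+
  then obtain k where k: "\<And>A B n z z'. A \<in> ?S \<Longrightarrow> B \<in> ?S \<Longrightarrow> n \<ge> k A B \<Longrightarrow> z \<in> B \<Longrightarrow> z' \<in> B \<Longrightarrow>
      z' \<in> cell n z \<Longrightarrow> F A (G B z') \<in> cell m (F A (G B z))"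
    by metis
  \<comment> \<open>\<open>Suc m\<close> keeps cells up to level \<open>m\<close> and siblings of
    level below \<open>m\<close> fixed under perturbation; the other entries control the finitely
    many maps. The inserted element also keeps the set nonempty when \<open>m = 0\<close>, where
    \<open>?S\<close> is empty.\<close>
  define N where "N = Max (insert (Suc m) ((\<lambda>(A, B). k A B) ` (?S \<times> ?S)))"
  have N: "N \<ge> Suc m" "\<And>A B. A \<in> ?S \<Longrightarrow> B \<in> ?S \<Longrightarrow> N \<ge> k A B"
    unfolding N_def using fin by (auto intro!: Max_ge)
  have close: "maltsev x y z \<in> cell m x" if xyz: "x \<in> topspace X" "y \<in> topspace X" "z \<in> cell m y" for x y z
  proof (cases "y = z")
    case True
    then show ?thesis
      using that mem_cell by (simp add: maltsev_def)
  next
    case False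
    then obtain n where n: "z \<in> sibling n y"
      using exists_sibling[of y z] xyz cell_subset_topspace by blast
    have "m \<le> n"
      using xyz(3) n cell_antimono[OF xyz(2), of "Suc n" m]
      by (cases "m \<le> n") (auto simp: sibling_def simp del: cell.simps)
    then show ?thesis
      using maltsev_sibling[OF xyz(1,2) n] cell_antimono[OF xyz(1)] unfolding sibling_def by blast
  qed
  have "maltsev x' y' z' \<in> cell m (maltsev x y z)"
    if X: "x \<in> topspace X" "y \<in> topspace X" "z \<in> topspace X"
      and near: "x' \<in> cell N x" "y' \<in> cell N y" "z' \<in> cell N z" for x y z x' y' z'
  proof -
    have X': "x' \<in> topspace X" "y' \<in> topspace X" "z' \<in> topspace X"
      using X near cell_subset_topspace by blast+
    have le: "w' \<in> cell n w" if "w' \<in> cell N w" "w \<in> topspace X" "n \<le> Suc m" for w w' n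
      using that N(1) cell_antimono[of w n N] by auto
    show ?thesis
    proof (cases "z \<in> cell m y")
      case True
      \<comment> \<open>Close arguments \<open>y\<close> and \<open>z\<close> stay close after
        perturbation, so \<open>close\<close> confines both values to the same level
        \<open>m\<close> cell, although different homeomorphisms may compute them.\<close>
      have "cell m z' = cell m y'"
        using cell_eq[OF X(2) True] cell_eq[OF X(2) le[OF near(2) X(2)]] cell_eq[OF X(3) le[OF near(3) X(3)]] by simp
      then have "z' \<in> cell m y'"
        using mem_cell[OF X'(3)] by auto
      then have "maltsev x' y' z' \<in> cell m x'"
        using close X' by blast
      moreover have "cell m x' = cell m x"
        using cell_eq[OF X(1) le[OF near(1) X(1)]] by simp
      moreover have "cell m (maltsev x y z) = cell m x"
        using close[OF X(1,2) True] by (rule cell_eq[OF X(1)])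
      ultimately show ?thesis
        by simp
    next
      case False
      then obtain n where n: "z \<in> sibling n y"
        using exists_sibling[of y z] X mem_cell by blast
      have "n < m"
        using False n cell_antimono[OF X(2), of m n] by (cases "n < m") (auto simp: sibling_def simp del: cell.simps)
      then have x: "x' \<in> cell (Suc n) x" and y: "y' \<in> cell (Suc n) y" and z: "z' \<in> cell (Suc n) z"
        using near X by (auto intro!: le simp del: cell.simps)
      \<comment> \<open>\<open>z'\<close> splits from \<open>y\<close> at the same level as
        \<open>z\<close>. With \<open>sx\<close> and \<open>sy\<close>, both triples then use the
        same map and differ only in its argument.\<close>
      have "cell (Suc n) z \<subseteq> sibling n y"
        using n cell_eq[OF X(3), of y "Suc n"] cell_eq[OF X(2), of z n] cell_Suc_subset[OF X(3), of n]
          cell_eq[OF X(3), of _ "Suc n"] cell_eq[OF X(2), of _ "Suc n"] mem_cell[OF X(3), of "Suc n"]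
        unfolding sibling_def by blast
      then have z'n: "z' \<in> sibling n y"
        using z by blast
      have sx: "sibling n x' = sibling n x" and sy: "sibling n y' = sibling n y"
        using sibling_eq X x y by auto
      have "F (sibling n x) (G (sibling n y) z') \<in> cell m (F (sibling n x) (G (sibling n y) z))"
        using \<open>n < m\<close> X n z'n near(3) by (intro k[OF _ _ N(2)]) auto
      then show ?thesis
        using maltsev_eq[OF X(2) n] maltsev_eq[OF X'(2), of z' n] sx sy z'n by simp
    qed
  qed
  then show ?thesis
    by blast
qed

section \<open>Continuity and the extension to the Cantor set\<close>

lemma openin_cell: "x \<in> topspace X \<Longrightarrow> openin X (cell n x)"
  using clopen cell_mem by blast

lemma strong_maltsev_maltsev: "strong_maltsev X maltsev"
proof -
  have "continuous_map (cube_topology X) X (\<lambda>(x, y, z). maltsev x y z)"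
    unfolding continuous_map_def
  proof (intro conjI allI impI)
    show "(\<lambda>(x, y, z). maltsev x y z) \<in> topspace (cube_topology X) \<rightarrow> topspace X"
      using maltsev_topspace by auto
    fix U assume U: "openin X U"
    show "openin (cube_topology X) {q \<in> topspace (cube_topology X). (\<lambda>(x, y, z). maltsev x y z) q \<in> U}"
      (is "openin _ ?S")
    proof (subst openin_subopen, intro ballI)
      fix q assume "q \<in> ?S"
      then obtain x y z where q: "q = (x, y, z)" "x \<in> topspace X" "y \<in> topspace X" "z \<in> topspace X"
          "maltsev x y z \<in> U"
        by auto
      obtain m where m: "cell m (maltsev x y z) \<subseteq> U"
        using cell_base[OF U q(5)] by blast
      obtain N where N: "\<forall>x\<in>topspace X. \<forall>y\<in>topspace X. \<forall>z\<in>topspace X.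
          \<forall>x'\<in>cell N x. \<forall>y'\<in>cell N y. \<forall>z'\<in>cell N z. maltsev x' y' z' \<in> cell m (maltsev x y z)"
        using maltsev_uniformly_continuous[of m] by blast
      let ?T = "cell N x \<times> cell N y \<times> cell N z"
      have "openin (cube_topology X) ?T"
        using q openin_cell by (simp add: openin_prod_Times_iff)
      moreover have "q \<in> ?T"
        using q mem_cell by simp
      moreover have "maltsev x' y' z' \<in> U" if "x' \<in> cell N x" "y' \<in> cell N y" "z' \<in> cell N z" for x' y' z'
        using N q(2-4) m that by blast
      then have "?T \<subseteq> ?S"
        using q cell_subset_topspace[of x N] cell_subset_topspace[of y N] cell_subset_topspace[of z N] by auto
      ultimately show "\<exists>T. openin (cube_topology X) T \<and> q \<in> T \<and> T \<subseteq> ?S"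
        by blast
    qed
  qed
  then show ?thesis
    unfolding strong_maltsev_def continuous_maltsev_def using maltsev_laws maltsev_strong by simp
qed

lemma inj_on_code: "inj_on code (topspace X)"
proof (rule inj_onI, rule ccontr)
  fix x y assume "x \<in> topspace X" "y \<in> topspace X" "code x = code y" "x \<noteq> y"
  then show False
    using exists_separating_cell[of x y] mem_cell_iff_code[of x y] by auto
qed

lemma embedding_map_code: "embedding_map X cantor_space code"
  unfolding embedding_map_def
proof (rule bijective_open_imp_homeomorphic_map)
  let ?Y = "subtopology cantor_space (code ` topspace X)"
  have "openin X {x \<in> topspace X. code x \<in> V}" if V: "openin cantor_space V" for V
  proof (subst openin_subopen, intro ballI)
    fix x assume x: "x \<in> {x \<in> topspace X. code x \<in> V}"
    then obtain n where n: "\<And>t. (\<forall>i<n. t i = code x i) \<Longrightarrow> t \<in> V"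
      using V unfolding openin_cantor_space by blast
    have "cell n x \<subseteq> {x \<in> topspace X. code x \<in> V}"
    proof
      fix w assume w: "w \<in> cell n x"
      then have wX: "w \<in> topspace X"
        using x cell_subset_topspace by blast
      then have "\<forall>i<n. code w i = code x i"
        using w x mem_cell_iff_code[of x w n] by simp
      then show "w \<in> {x \<in> topspace X. code x \<in> V}"
        using wX n by simp
    qed
    then show "\<exists>T. openin X T \<and> x \<in> T \<and> T \<subseteq> {x \<in> topspace X. code x \<in> V}"
      using x openin_cell[of x n] mem_cell[of x n] by blast
  qed
  then have "continuous_map X cantor_space code"
    by (simp add: continuous_map_def)
  then show "continuous_map X ?Y code"
    by (simp add: continuous_map_in_subtopology)
  show "open_map X ?Y code"
    unfolding open_map_def
  proof (intro allI impI)
    fix U assume U: "openin X U"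
    \<comment> \<open>The union of the cylinders of all cells inside \<open>U\<close>. Cells form a
      base, so its trace on the codes is exactly the image of \<open>U\<close>.\<close>
    define W where "W = {t. \<exists>x\<in>U. \<exists>n. cell n x \<subseteq> U \<and> (\<forall>i<n. t i = code x i)}"
    have "\<exists>n. \<forall>t'. (\<forall>i<n. t' i = t i) \<longrightarrow> t' \<in> W" if t: "t \<in> W" for t
    proof -
      obtain x n where x: "x \<in> U" "cell n x \<subseteq> U" "\<forall>i<n. t i = code x i"
        using t unfolding W_def by blast
      then have "t' \<in> W" if "\<forall>i<n. t' i = t i" for t'
        using that unfolding W_def by auto
      then show ?thesis
        by blast
    qed
    then have "openin cantor_space W"
      by (simp add: openin_cantor_space)
    moreover have "code ` U = W \<inter> code ` topspace X"
    proof (intro equalityI subsetI)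
      fix t assume "t \<in> code ` U"
      then obtain x where x: "x \<in> U" "t = code x"
        by blast
      obtain n where "cell n x \<subseteq> U"
        using cell_base[OF U x(1)] by blast
      then show "t \<in> W \<inter> code ` topspace X"
        using x openin_subset[OF U] unfolding W_def by auto
    next
      fix t assume "t \<in> W \<inter> code ` topspace X"
      then obtain w x n where "w \<in> topspace X" "t = code w" and x: "x \<in> U" "cell n x \<subseteq> U"
          and eq: "\<forall>i<n. t i = code x i"
        unfolding W_def by auto
      then show "t \<in> code ` U"
        using mem_cell_iff_code[of x w n] openin_subset[OF U] by blast
    qed
    ultimately show "openin ?Y (code ` U)"
      by (auto simp: openin_subtopology)
  qed
qed (use inj_on_code in auto)

text \<open>The extension is written down bit by bit: each output bit is evaluated at points of
  \<open>X\<close> that share long enough prefixes with the arguments, and uniform continuity makes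
  this correct on codes.\<close>

lemma maltsev_extension_code: "maltsev_extension X maltsev cantor_space code"
proof -
  have dense: "cantor_space closure_of (code ` topspace X) = topspace cantor_space"
  proof -
    have "s \<in> cantor_space closure_of (code ` topspace X)" for s
      unfolding in_closure_of
    proof (intro conjI allI impI)
      fix V assume "s \<in> V \<and> openin cantor_space V"
      then obtain n where n: "\<And>t. (\<forall>i<n. t i = s i) \<Longrightarrow> t \<in> V"
        unfolding openin_cantor_space by blast
      then show "\<exists>t. t \<in> code ` topspace X \<and> t \<in> V"
        using exists_code_prefix[of n s] by blast
    qed simp
    then show ?thesis
      by auto
  qed
  \<comment> \<open>The representative depends only on the first \<open>n\<close> bits of
    \<open>s\<close>, by \<open>point_cong\<close>; hence every output bit of \<open>Q\<close> is
    locally constant.\<close>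
  define point where "point n s = (SOME x. x \<in> topspace X \<and> (\<forall>i<n. code x i = s i))" for n s
  have point: "point n s \<in> topspace X" "\<And>i. i < n \<Longrightarrow> code (point n s) i = s i" for n s
  proof -
    have "\<exists>x. x \<in> topspace X \<and> (\<forall>i<n. code x i = s i)"
      using exists_code_prefix by blast
    from someI_ex[OF this] show "point n s \<in> topspace X" "\<And>i. i < n \<Longrightarrow> code (point n s) i = s i"
      unfolding point_def by auto
  qed
  have point_cong: "point n s = point n t" if "\<forall>i<n. t i = s i" for n s t
    using that unfolding point_def by (intro arg_cong[of _ _ Eps] ext) auto
  have point_cell: "point n (code x) \<in> cell n x" if "x \<in> topspace X" for n x
    using that point mem_cell_iff_code by simp
  obtain N where N: "\<And>m x y z x' y' z'. x \<in> topspace X \<Longrightarrow> y \<in> topspace X \<Longrightarrow> z \<in> topspace X \<Longrightarrow>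
      x' \<in> cell (N m) x \<Longrightarrow> y' \<in> cell (N m) y \<Longrightarrow> z' \<in> cell (N m) z \<Longrightarrow>
      maltsev x' y' z' \<in> cell m (maltsev x y z)"
    using maltsev_uniformly_continuous by metis
  \<comment> \<open>Bit \<open>m\<close> is constant on cells of level \<open>m + 1\<close>, not of
    level \<open>m\<close>.\<close>
  define M where "M m = N (Suc m)" for m
  define Q where "Q r s t = (\<lambda>m. code (maltsev (point (M m) r) (point (M m) s) (point (M m) t)) m)" for r s t
  have "continuous_map (cube_topology cantor_space) (discrete_topology UNIV) (\<lambda>(r, s, t). Q r s t m)" for m
    unfolding continuous_map_def
  proof (intro conjI allI impI)
    fix U :: "bool set"
    define cyl :: "(nat \<Rightarrow> bool) \<Rightarrow> (nat \<Rightarrow> bool) set" where "cyl s = {t. \<forall>i<M m. t i = s i}" for s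
    have cyl: "openin cantor_space (cyl s)" for s
      unfolding openin_cantor_space cyl_def by (intro ballI exI[of _ "M m"]) auto
    show "openin (cube_topology cantor_space)
        {q \<in> topspace (cube_topology cantor_space). (\<lambda>(r, s, t). Q r s t m) q \<in> U}" (is "openin _ ?S")
    proof (subst openin_subopen, intro ballI)
      fix q assume "q \<in> ?S"
      moreover obtain r s t where "q = (r, s, t)"
        by (cases q)
      ultimately have q: "q = (r, s, t)" "Q r s t m \<in> U"
        by auto
      let ?T = "cyl r \<times> cyl s \<times> cyl t"
      have "Q r' s' t' m = Q r s t m" if "r' \<in> cyl r" "s' \<in> cyl s" "t' \<in> cyl t" for r' s' t'
        using that point_cong[of "M m" r' r] point_cong[of "M m" s' s] point_cong[of "M m" t' t]
        unfolding Q_def cyl_def by simp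
      then have "?T \<subseteq> ?S"
        using q by auto
      moreover have "openin (cube_topology cantor_space) ?T"
        using cyl by (simp add: openin_prod_Times_iff)
      moreover have "q \<in> ?T"
        using q by (simp add: cyl_def)
      ultimately show "\<exists>T. openin (cube_topology cantor_space) T \<and> q \<in> T \<and> T \<subseteq> ?S"
        by blast
    qed
  qed auto
  then have "continuous_map (cube_topology cantor_space)
      (product_topology (\<lambda>_. discrete_topology UNIV) UNIV) (\<lambda>(r, s, t). Q r s t)"
    by (simp add: continuous_map_componentwise_UNIV case_prod_unfold)
  then have "continuous_map (cube_topology cantor_space) cantor_space (\<lambda>(r, s, t). Q r s t)"
    by (fold cantor_space_def)
  moreover have "Q (code x) (code y) (code z) = code (maltsev x y z)"
    if "x \<in> topspace X" "y \<in> topspace X" "z \<in> topspace X" for x y z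
  proof
    fix m
    let ?w = "maltsev (point (M m) (code x)) (point (M m) (code y)) (point (M m) (code z))"
    have "?w \<in> cell (Suc m) (maltsev x y z)"
      using that point_cell unfolding M_def by (intro N) auto
    then show "Q (code x) (code y) (code z) m = code (maltsev x y z) m"
      unfolding Q_def using that point mem_cell_iff_code[of "maltsev x y z" ?w "Suc m"] maltsev_topspace by simp
  qed
  ultimately show ?thesis
    unfolding maltsev_extension_def compact_extension_def
    using compact_Hausdorff_cantor_space embedding_map_code dense by blast
qed

text \<open>Siblings of different levels along the branch of \<open>x\<close> are disjoint, so one
  point from each gives an infinite sequence. It makes \<open>'a set set\<close> large enough to
  carry a copy of the Cantor set.\<close>

lemma inj_nat_topspace: "\<exists>d :: nat \<Rightarrow> 'a. inj d"
proof -
  obtain x where x: "x \<in> topspace X"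
    using nonempty by blast
  have "\<exists>d. \<forall>n. d n \<in> sibling n x"
    using sibling_nonempty[OF x] by (intro choice) blast
  then obtain d where d: "\<And>n. d n \<in> sibling n x"
    by blast
  then have "inj d"
    using split_level_eq[OF x] by (metis injI)
  then show ?thesis
    by blast
qed

end

section \<open>A countable clopen algebra invariant under the homeomorphisms\<close>

lemma countable_closure_under_operations:
  fixes f :: "nat \<Rightarrow> 'b \<Rightarrow> 'b \<Rightarrow> 'b"
  assumes "countable \<A>" "\<A> \<subseteq> M" "\<And>i A B. A \<in> M \<Longrightarrow> B \<in> M \<Longrightarrow> f i A B \<in> M"
  obtains \<C> where "countable \<C>" "\<A> \<subseteq> \<C>" "\<C> \<subseteq> M" "\<And>i A B. A \<in> \<C> \<Longrightarrow> B \<in> \<C> \<Longrightarrow> f i A B \<in> \<C>"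
proof -
  define step where "step S = S \<union> (\<lambda>(i, A, B). f i A B) ` (UNIV \<times> S \<times> S)" for S
  define S where "S n = (step ^^ n) \<A>" for n
  have S: "S 0 = \<A>" "S (Suc n) = step (S n)" for n
    by (auto simp: S_def)
  have "countable (S n)" for n
    by (induction n) (use assms(1) in \<open>auto simp: S step_def\<close>)
  moreover have "S n \<subseteq> M" for n
    by (induction n) (use assms(2,3) in \<open>auto simp: S step_def subset_iff\<close>)
  moreover have mono: "S m \<subseteq> S n" if "m \<le> n" for m n
    using that by (rule lift_Suc_mono_le[rotated]) (auto simp: S step_def)
  have "f i A B \<in> (\<Union>n. S n)" if "A \<in> (\<Union>n. S n)" "B \<in> (\<Union>n. S n)" for i A B
  proof -
    obtain m n where mn: "A \<in> S m" "B \<in> S n"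
      using \<open>A \<in> _\<close> \<open>B \<in> _\<close> by blast
    then have "A \<in> S (max m n)" "B \<in> S (max m n)"
      using mono max.cobounded1 max.cobounded2 by blast+
    then have "f i A B \<in> S (Suc (max m n))"
      by (force simp: S step_def)
    then show ?thesis
      by blast
  qed
  moreover have "\<A> \<subseteq> (\<Union>n. S n)"
    using S(1) by blast
  ultimately show thesis
    by (intro that[of "\<Union>n. S n"]) auto
qed

text \<open>An isolated point would be a nonempty clopen singleton homeomorphic to \<open>X\<close>.
  Its absence is the source of \<open>proper_part\<close>.\<close>

lemma strongly_homogeneous_no_isolated_point:
  assumes X: "strongly_homogeneous X" "Hausdorff_space X"
    and xy: "x \<in> topspace X" "y \<in> topspace X" "x \<noteq> y"
  shows "\<not> openin X {a}"
proof
  assume a: "openin X {a}"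
  then have "a \<in> topspace X"
    using openin_subset by blast
  then have "closedin X {a}"
    using X(2) by (simp add: closedin_Hausdorff_sing_eq)
  then have "subtopology X {a} homeomorphic_space X"
    using a X(1) by (auto simp: strongly_homogeneous_def)
  then obtain f where "homeomorphic_map (subtopology X {a}) X f"
    by (auto simp: homeomorphic_space)
  then have "topspace X \<subseteq> f ` {a}"
    using homeomorphic_imp_surjective_map by fastforce
  then have "x = f a" "y = f a"
    using xy(1,2) by auto
  then show False
    using xy(3) by simp
qed

lemma strongly_homogeneous_clopen_splitting:
  assumes X: "strongly_homogeneous X" "Hausdorff_space X" "second_countable X" "X dim_le 0"
    and xy: "x \<in> topspace X" "y \<in> topspace X" "x \<noteq> y"
  obtains \<C> b F G where "clopen_splitting X \<C> b F G"
proof -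
  define M where "M = {A. openin X A \<and> closedin X A}"
  obtain \<A> where \<A>: "countable \<A>" "\<And>A. A \<in> \<A> \<Longrightarrow> openin X A \<and> closedin X A"
    "\<And>U x. openin X U \<Longrightarrow> x \<in> U \<Longrightarrow> \<exists>A\<in>\<A>. x \<in> A \<and> A \<subseteq> U"
    using countable_clopen_base[OF X(3,4)] by blast
  \<comment> \<open>The maps are chosen for all clopen sets before the algebra exists, so closing
    under them never calls for new choices.\<close>
  have "\<forall>A. \<exists>f g. A \<in> M \<and> A \<noteq> {} \<longrightarrow> homeomorphic_maps X (subtopology X A) f g"
    using X(1) homeomorphic_space_sym unfolding strongly_homogeneous_def M_def homeomorphic_space_def
    by blast
  then obtain F G where FG: "\<And>A. A \<in> M \<Longrightarrow> A \<noteq> {} \<Longrightarrow> homeomorphic_maps X (subtopology X A) (F A) (G A)"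
    by metis
  \<comment> \<open>The case \<open>A = {}\<close> is separate because \<open>F {}\<close> is arbitrary.\<close>
  define f where "f i A B = (if i = 0 then A - B else if A = {} then {}
      else if i = 1 then F A ` B else {x \<in> topspace X. F A x \<in> B})" for i :: nat and A B
  have "f i A B \<in> M" if AB: "A \<in> M" "B \<in> M" for i A B
  proof -
    have img: "F A ` B \<in> M" "{x \<in> topspace X. F A x \<in> B} \<in> M" if "A \<noteq> {}"
    proof -
      have hom: "homeomorphic_map X (subtopology X A) (F A)"
        using FG[OF AB(1) that] homeomorphic_map_maps by blast
      have B: "B \<subseteq> topspace X" "openin X B" "closedin X B" and A: "openin X A" "closedin X A"
        using AB openin_subset by (auto simp: M_def)
      show "F A ` B \<in> M"
        using homeomorphic_map_openness[OF hom B(1)] homeomorphic_map_closedness[OF hom B(1)] A B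
          openin_trans_full closedin_trans_full unfolding M_def by blast
      have "continuous_map X X (F A)"
        using hom by (meson continuous_map_into_fulltopology homeomorphic_imp_continuous_map)
      then show "{x \<in> topspace X. F A x \<in> B} \<in> M"
        using B openin_continuous_map_preimage closedin_continuous_map_preimage unfolding M_def by blast
    qed
    have "A - B \<in> M" "{} \<in> M"
      using AB by (auto simp: M_def)
    with img show ?thesis
      unfolding f_def by simp
  qed
  moreover have "insert (topspace X) \<A> \<subseteq> M"
    using \<A>(2) by (auto simp: M_def)
  moreover have "countable (insert (topspace X) \<A>)"
    using \<A>(1) by simp
  ultimately obtain \<C> where \<C>: "countable \<C>" "insert (topspace X) \<A> \<subseteq> \<C>" "\<C> \<subseteq> M"
      "\<And>i A B. A \<in> \<C> \<Longrightarrow> B \<in> \<C> \<Longrightarrow> f i A B \<in> \<C>"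
    using countable_closure_under_operations[of "insert (topspace X) \<A>" M f] by metis
  have base: "\<exists>A\<in>\<C>. x \<in> A \<and> A \<subseteq> U" if "openin X U" "x \<in> U" for U x
    using \<A>(3)[OF that] \<C>(2) by blast
  have "clopen_splitting X \<C> (from_nat_into \<C>) F G"
  proof
    show "range (from_nat_into \<C>) = \<C>"
      using \<C> by (intro range_from_nat_into) auto
    show "openin X A \<and> closedin X A" if "A \<in> \<C>" for A
      using that \<C>(3) by (auto simp: M_def)
    show "A - B \<in> \<C>" if "A \<in> \<C>" "B \<in> \<C>" for A B
      using \<C>(4)[OF that, of 0] by (simp add: f_def)
    show "F A ` B \<in> \<C>" if "A \<in> \<C>" "A \<noteq> {}" "B \<in> \<C>" for A B
      using \<C>(4)[OF that(1,3), of 1] that by (simp add: f_def)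
    show "{x \<in> topspace X. F A x \<in> B} \<in> \<C>" if "A \<in> \<C>" "A \<noteq> {}" "B \<in> \<C>" for A B
      using \<C>(4)[OF that(1,3), of 2] that by (simp add: f_def)
    show "homeomorphic_maps X (subtopology X A) (F A) (G A)" if "A \<in> \<C>" "A \<noteq> {}" for A
      using FG that \<C>(3) by blast
    show "\<exists>B\<in>\<C>. B \<subset> A \<and> B \<noteq> {}" if A: "A \<in> \<C>" "A \<noteq> {}" for A
    proof -
      obtain a where a: "a \<in> A"
        using A by blast
      have open_A: "openin X A"
        using A \<C>(3) by (auto simp: M_def)
      then have "A \<noteq> {a}"
        using strongly_homogeneous_no_isolated_point[OF X(1,2) xy] by blast
      then obtain c where c: "c \<in> A - {a}"
        using a by blast
      have "a \<in> topspace X"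
        using a open_A openin_subset by blast
      then have "closedin X {a}"
        using X(2) by (simp add: closedin_Hausdorff_sing_eq)
      \<comment> \<open>A basic member around \<open>c\<close> inside this open set misses
        \<open>a\<close>, so it is a proper part of \<open>A\<close>.\<close>
      then have "openin X (A - {a})"
        using open_A by (rule openin_diff[rotated])
      then show ?thesis
        using base[OF _ c] a by blast
    qed
  qed (use X xy \<C> base in auto)
  then show thesis
    by (rule that)
qed

section \<open>The chosen completion and the final cases\<close>

lemma maltsev_completion_homeomorphic:
  fixes X :: "'a topology" and B :: "'a set set topology"
  assumes "continuous_maltsev X P" and "maltsev_extension X P B e"
  shows "maltsev_completion X P homeomorphic_space B"
proof -
  have "\<exists>B :: 'a set set topology. \<exists>e. maltsev_extension X P B e"
    using assms(2) by blast
  from someI_ex[OF this] obtain e' where "maltsev_extension X P (maltsev_completion X P) e'"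
    unfolding maltsev_completion_def by blast
  from maltsev_extension_unique[OF assms(1) this assms(2)] show ?thesis .
qed

text \<open>Such a space, possibly empty, is finite and thus its own compact extension; the first
  projection satisfies every law. The map to \<open>{{x}}\<close> only adjusts the type.\<close>

lemma precompact_strongly_rectifiable_subsingleton:
  fixes X :: "'a topology"
  assumes X: "\<And>x y. x \<in> topspace X \<Longrightarrow> y \<in> topspace X \<Longrightarrow> x = y"
  shows "precompact_strongly_rectifiable X"
proof -
  have cont: "continuous_map (cube_topology X) X (\<lambda>(x, y, z). x)"
    using continuous_map_fst[of X "prod_topology X X"] by (simp add: case_prod_unfold)
  have strong: "strong_maltsev X (\<lambda>x y z. x)"
    unfolding strong_maltsev_def continuous_maltsev_def using cont X by blast
  have "finite (topspace X)"
  proof (cases "topspace X = {}")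
    case False
    then obtain x where "x \<in> topspace X"
      by blast
    then have "topspace X \<subseteq> {x}"
      using X by blast
    then show ?thesis
      using finite_subset by blast
  qed simp
  then have "compact_extension X X id"
    unfolding compact_extension_def
    using X compact_space_def finite_imp_compactin[of "topspace X" X]
    by (auto simp: Hausdorff_space_def embedding_map_def homeomorphic_map_id)
  then have ext: "maltsev_extension X (\<lambda>x y z. x) X id"
    unfolding maltsev_extension_def using cont by (intro conjI exI[of _ "\<lambda>x y z. x"]) auto
  have "inj_on (\<lambda>x. {{x}}) (topspace X)"
    by (auto simp: inj_on_def)
  then obtain B where "homeomorphic_map X B (\<lambda>x. {{x}})"
    using ex_homeomorphic_copy by blast
  from maltsev_extension_transport[OF ext this] show ?thesis
    unfolding precompact_strongly_rectifiable_def precompact_maltsev_def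
    using strong by (auto simp: strong_maltsev_def)
qed

theorem theorem4:
  fixes X :: "'a topology"
  assumes "strongly_homogeneous X"
    and "separable_space X"
    and "metrizable_space X"
    and "X dim_le 0"
  shows "precompact_strongly_rectifiable X \<and>
         ((\<exists>x\<in>topspace X. \<exists>y\<in>topspace X. x \<noteq> y) \<longrightarrow>
          (\<exists>P. strong_maltsev X P \<and> precompact_maltsev X P \<and>
               maltsev_completion X P homeomorphic_space cantor_space))"
proof (cases "\<exists>x\<in>topspace X. \<exists>y\<in>topspace X. x \<noteq> y")
  case True
  then obtain x y where xy: "x \<in> topspace X" "y \<in> topspace X" "x \<noteq> y"
    by blast
  have "Hausdorff_space X" "second_countable X"
    using assms metrizable_imp_Hausdorff_space metrizable_separable_imp_second_countable by blast+
  then obtain \<C> b F G where "clopen_splitting X \<C> b F G"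
    using strongly_homogeneous_clopen_splitting assms xy by metis
  then interpret clopen_splitting X \<C> b F G .
  have strong: "strong_maltsev X maltsev"
    by (rule strong_maltsev_maltsev)
  then have cont: "continuous_maltsev X maltsev"
    by (simp add: strong_maltsev_def)
  \<comment> \<open>A 0-1 sequence is encoded as a set of points through \<open>d\<close>, and
    wrapped in a singleton to reach the type \<open>'a set set\<close>.\<close>
  obtain d :: "nat \<Rightarrow> 'a" where "inj d"
    using inj_nat_topspace by blast
  then have "inj (\<lambda>s. {d ` {n. s n}})"
    by (auto simp: inj_def inj_image_eq_iff)
  then obtain B :: "'a set set topology" where B: "homeomorphic_map cantor_space B (\<lambda>s. {d ` {n. s n}})"
    using ex_homeomorphic_copy[of "\<lambda>s. {d ` {n. s n}}" cantor_space] by auto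
  have ext: "maltsev_extension X maltsev B ((\<lambda>s. {d ` {n. s n}}) \<circ> code)"
    using maltsev_extension_code B by (rule maltsev_extension_transport)
  have "maltsev_completion X maltsev homeomorphic_space B"
    using cont ext by (rule maltsev_completion_homeomorphic)
  then have "maltsev_completion X maltsev homeomorphic_space cantor_space"
    using homeomorphic_map_imp_homeomorphic_space[OF B] homeomorphic_space_sym homeomorphic_space_trans by blast
  moreover have "precompact_maltsev X maltsev"
    unfolding precompact_maltsev_def using cont ext by blast
  ultimately show ?thesis
    unfolding precompact_strongly_rectifiable_def using strong by blast
next
  case False
  then show ?thesis
    using precompact_strongly_rectifiable_subsingleton[of X] by blast
qed

end
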